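(* There is an algorithm which, given any positive integers $n,m$ with $m\le\binom n2$ and any convex function $f:\{0,1,\dots,m\}\rightarrow\mathbb{R}$, finds, in $O(n^2m)$ time, a (simple) graph $G$ on $[n]$ with $m$ edges whose degree sequence $d=(d_1,\dots,d_n)$ maximizes $\sum_{i=1}^n f(d_i)$ over all graphs on $[n]$ with $m$ edges.
   Context: Let $[n]:=\{1,\dots,n\}$. The degree sequence of a simple graph $G=([n],E)$ is the vector $d=(d_1,\dots,d_n)$ with $d_i=|\{e\in E:i\in e\}|$. This is the problem of optimization over degree sequences of $k$-hypergraphs for $k=2$ with identical univariate convex functions $f_1=\cdots=f_n=f$. A function $f:\{0,1,\dots,m\}\rightarrow\mathbb{R}$ is convex if it is the restriction of a convex function on $\mathbb{R}$, i.e. $2f(t)\le f(t-1)+f(t+1)$ for $0<t<m$. The function $f$ is given by its values (each value $f(t)$ is available in unit time, and arithmetic operations and comparisons are counted as unit-time operations). *)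

theory Defs
  imports "HOL-Analysis.Convex"
begin

section \<open>Graphs on \<open>[n]\<close> and their degrees\<close>

definition simple_graph :: "nat \<Rightarrow> nat set set \<Rightarrow> bool" where
  "simple_graph n E \<longleftrightarrow> (\<forall>e\<in>E. e \<subseteq> {1..n} \<and> card e = 2)"

definition deg :: "nat set set \<Rightarrow> nat \<Rightarrow> nat" where
  "deg E i = card {e \<in> E. i \<in> e}"

definition maximizes_degree_sum :: "nat \<Rightarrow> nat \<Rightarrow> (nat \<Rightarrow> real) \<Rightarrow> nat set set \<Rightarrow> bool" where
  "maximizes_degree_sum n m f E \<longleftrightarrow>
     simple_graph n E \<and> card E = m \<and>
     (\<forall>E'. simple_graph n E' \<and> card E' = m \<longrightarrow>
        (\<Sum>i\<in>{1..n}. f (deg E' i)) \<le> (\<Sum>i\<in>{1..n}. f (deg E i)))"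

text \<open>A function on \<open>{0,\<dots>,m}\<close> is represented by a total function of which only the values
  on \<open>{0..m}\<close> matter.\<close>

definition convex_upto :: "nat \<Rightarrow> (nat \<Rightarrow> real) \<Rightarrow> bool" where
  "convex_upto m f \<longleftrightarrow>
     (\<exists>g :: real \<Rightarrow> real. convex_on UNIV g \<and> (\<forall>t\<in>{0..m}. f t = g (real t)))"


section \<open>A unit-cost random access machine with real arithmetic\<close>

text \<open>Algorithms are programs of a while language.  The store consists of named unbounded arrays
  of natural numbers and named unbounded arrays of reals; a scalar variable is cell \<open>0\<close> of an array.
  Array indices are computed, so there is indirect addressing.  A program only mentions finitely
  many names.  Each arithmetic operation, comparison, memory access, constant and control step
  costs one time unit.

  The only numeric literals are natural numbers: arbitrary real literals could smuggle
  uncomputable information into a program.  There is no rounding from reals to naturals.\<close>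

record store =
  nats :: "string \<Rightarrow> nat \<Rightarrow> nat"
  reals :: "string \<Rightarrow> nat \<Rightarrow> real"

datatype nexp =
    NConst nat
  | NCell string nexp
  | NAdd nexp nexp
  | NSub nexp nexp
  | NMul nexp nexp

datatype rexp =
    ROfNat nexp
  | RCell string nexp
  | RAdd rexp rexp
  | RSub rexp rexp
  | RMul rexp rexp
  | RDiv rexp rexp

datatype bexp =
    NLess nexp nexp
  | RLess rexp rexp
  | BNot bexp
  | BAnd bexp bexp

datatype com =
    Skip
  | NAssign string nexp nexp
  | RAssign string nexp rexp
  | Seq com com
  | Cond bexp com com
  | While bexp com

text \<open>Subtraction of naturals is truncated, and division of reals by \<open>0\<close> yields \<open>0\<close>.\<close>

primrec nval :: "store \<Rightarrow> nexp \<Rightarrow> nat" where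
  "nval s (NConst k) = k"
| "nval s (NCell x a) = nats s x (nval s a)"
| "nval s (NAdd a b) = nval s a + nval s b"
| "nval s (NSub a b) = nval s a - nval s b"
| "nval s (NMul a b) = nval s a * nval s b"

primrec rval :: "store \<Rightarrow> rexp \<Rightarrow> real" where
  "rval s (ROfNat a) = real (nval s a)"
| "rval s (RCell x a) = reals s x (nval s a)"
| "rval s (RAdd a b) = rval s a + rval s b"
| "rval s (RSub a b) = rval s a - rval s b"
| "rval s (RMul a b) = rval s a * rval s b"
| "rval s (RDiv a b) = rval s a / rval s b"

primrec bval :: "store \<Rightarrow> bexp \<Rightarrow> bool" where
  "bval s (NLess a b) \<longleftrightarrow> nval s a < nval s b"
| "bval s (RLess a b) \<longleftrightarrow> rval s a < rval s b"
| "bval s (BNot p) \<longleftrightarrow> \<not> bval s p"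
| "bval s (BAnd p q) \<longleftrightarrow> bval s p \<and> bval s q"

primrec ncost :: "nexp \<Rightarrow> nat" where
  "ncost (NConst k) = 1"
| "ncost (NCell x a) = 1 + ncost a"
| "ncost (NAdd a b) = 1 + ncost a + ncost b"
| "ncost (NSub a b) = 1 + ncost a + ncost b"
| "ncost (NMul a b) = 1 + ncost a + ncost b"

primrec rcost :: "rexp \<Rightarrow> nat" where
  "rcost (ROfNat a) = 1 + ncost a"
| "rcost (RCell x a) = 1 + ncost a"
| "rcost (RAdd a b) = 1 + rcost a + rcost b"
| "rcost (RSub a b) = 1 + rcost a + rcost b"
| "rcost (RMul a b) = 1 + rcost a + rcost b"
| "rcost (RDiv a b) = 1 + rcost a + rcost b"

primrec bcost :: "bexp \<Rightarrow> nat" where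
  "bcost (NLess a b) = 1 + ncost a + ncost b"
| "bcost (RLess a b) = 1 + rcost a + rcost b"
| "bcost (BNot p) = 1 + bcost p"
| "bcost (BAnd p q) = 1 + bcost p + bcost q"

definition nupdate :: "string \<Rightarrow> nat \<Rightarrow> nat \<Rightarrow> store \<Rightarrow> store" where
  "nupdate x i v s = s\<lparr>nats := (nats s)(x := (nats s x)(i := v))\<rparr>"

definition rupdate :: "string \<Rightarrow> nat \<Rightarrow> real \<Rightarrow> store \<Rightarrow> store" where
  "rupdate x i v s = s\<lparr>reals := (reals s)(x := (reals s x)(i := v))\<rparr>"

text \<open>\<open>runs c s t s'\<close>: started in store \<open>s\<close>, program \<open>c\<close> halts after exactly \<open>t\<close> time units in
  store \<open>s'\<close>.\<close>

inductive runs :: "com \<Rightarrow> store \<Rightarrow> nat \<Rightarrow> store \<Rightarrow> bool" where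
  Skip: "runs Skip s 1 s"
| NAssign: "runs (NAssign x a b) s (1 + ncost a + ncost b) (nupdate x (nval s a) (nval s b) s)"
| RAssign: "runs (RAssign x a b) s (1 + ncost a + rcost b) (rupdate x (nval s a) (rval s b) s)"
| Seq: "runs c s t s' \<Longrightarrow> runs d s' u s'' \<Longrightarrow> runs (Seq c d) s (1 + t + u) s''"
| CondTrue: "bval s p \<Longrightarrow> runs c s t s' \<Longrightarrow> runs (Cond p c d) s (1 + bcost p + t) s'"
| CondFalse: "\<not> bval s p \<Longrightarrow> runs d s t s' \<Longrightarrow> runs (Cond p c d) s (1 + bcost p + t) s'"
| WhileFalse: "\<not> bval s p \<Longrightarrow> runs (While p c) s (1 + bcost p) s"
| WhileTrue: "bval s p \<Longrightarrow> runs c s t s' \<Longrightarrow> runs (While p c) s' u s'' \<Longrightarrow>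
    runs (While p c) s (1 + bcost p + t + u) s''"

inductive_cases SkipE: "runs Skip s t s'"
inductive_cases NAssignE: "runs (NAssign x a b) s t s'"
inductive_cases RAssignE: "runs (RAssign x a b) s t s'"
inductive_cases SeqE: "runs (Seq c d) s t s'"
inductive_cases CondE: "runs (Cond p c d) s t s'"
inductive_cases WhileE: "runs (While p c) s t s'"

lemma runs_deterministic:
  "runs c s t s' \<Longrightarrow> runs c s t1 s1 \<Longrightarrow> t1 = t \<and> s1 = s'"
proof (induction arbitrary: t1 s1 rule: runs.induct)
  case Skip
  show ?case by (rule SkipE[OF Skip.prems]) simp
next
  case NAssign
  show ?case by (rule NAssignE[OF NAssign.prems]) simp
next
  case RAssign
  show ?case by (rule RAssignE[OF RAssign.prems]) simp
next
  case (Seq c s t s' d u s'')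
  show ?case
  proof (rule SeqE[OF Seq.prems])
    fix t2 s2 u2
    assume eq: "t1 = Suc (t2 + u2)" and c: "runs c s t2 s2" and d: "runs d s2 u2 s1"
    from Seq.IH(1)[OF c] have c': "t2 = t" "s2 = s'" by simp_all
    from Seq.IH(2)[OF d[unfolded c'(2)]] eq c' show ?thesis by simp
  qed
next
  case CondTrue
  show ?case
    by (rule CondE[OF CondTrue.prems]) (use CondTrue.hyps(1) in \<open>auto dest: CondTrue.IH\<close>)
next
  case CondFalse
  show ?case
    by (rule CondE[OF CondFalse.prems]) (use CondFalse.hyps(1) in \<open>auto dest: CondFalse.IH\<close>)
next
  case WhileFalse
  show ?case by (rule WhileE[OF WhileFalse.prems]) (use WhileFalse.hyps(1) in simp_all)
next
  case (WhileTrue s p c t s' u s'')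
  show ?case
  proof (rule WhileE[OF WhileTrue.prems])
    fix t2 s2 u2
    assume eq: "t1 = Suc (bcost p + t2 + u2)" and c: "runs c s t2 s2"
      and d: "runs (While p c) s2 u2 s1"
    from WhileTrue.IH(1)[OF c] have c': "t2 = t" "s2 = s'" by simp_all
    from WhileTrue.IH(2)[OF d[unfolded c'(2)]] eq c' show ?thesis by simp
  qed (use WhileTrue.hyps(1) in simp)
qed


section \<open>Input and output conventions\<close>

text \<open>The value table of \<open>f\<close> sits in a real array, one cell per value, so that each value is
  available in unit time.  Values outside \<open>{0..m}\<close> are not supplied.\<close>

definition input_store :: "nat \<Rightarrow> nat \<Rightarrow> (nat \<Rightarrow> real) \<Rightarrow> store" where
  "input_store n m f =
     \<lparr>nats = (\<lambda>x i. if x = ''n'' \<and> i = 0 then n else if x = ''m'' \<and> i = 0 then m else 0),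
      reals = (\<lambda>x i. if x = ''f'' \<and> i \<le> m then f i else 0)\<rparr>"

text \<open>The output graph is a list of \<open>m\<close> edges: the ends of edge number \<open>k < m\<close> are in cell \<open>k\<close> of
  the arrays \<open>u\<close> and \<open>v\<close>.\<close>

definition output_edges :: "nat \<Rightarrow> store \<Rightarrow> nat set set" where
  "output_edges m s = (\<lambda>k. {nats s ''u'' k, nats s ''v'' k}) ` {..<m}"

end

theory Submission imports Defs begin

text \<open>Moving an edge \<open>{k, y}\<close> to \<open>{x, y}\<close>, where the degree of \<open>x\<close> is at least that of \<open>k\<close>, drives
  two degrees further apart.  This does not decrease a convex degree sum, and it strictly increases
  the sum of the squared degrees.  So among the graphs that are at least as good as a given graph,
  one with the largest sum of squares admits no such move at a vertex \<open>x\<close> of maximum degree: \<open>x\<close> is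
  adjacent to every vertex that has a neighbour other than \<open>x\<close>.  Hence \<open>x\<close> is adjacent to all other
  vertices, or some vertex is isolated (\<open>exists_dominating_or_isolated\<close>).  Deleting that vertex and
  repeating the argument reduces the search to graphs that are built by adding dominating and
  isolated vertices, known as threshold graphs.

  When a vertex is deleted, its final degree is already determined: if \<open>d\<close> dominating vertices were
  deleted before it and \<open>q\<close> vertices remain after it, the degree is \<open>d + q\<close> for a dominating vertex
  and \<open>d\<close> for an isolated one.  The vertices that remain form an optimization problem of the same
  kind, which depends only on their number \<open>r\<close>, on \<open>d\<close>, and on the number \<open>e\<close> of edges left.  This
  gives the recurrence \<open>best\<close>, with \<open>O(n\<^sup>2)\<close> pairs \<open>(r, d)\<close>, \<open>m + 1\<close> values of \<open>e\<close>, and constant work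
  for each triple.  Its value bounds every graph
  (\<open>best_upper_bound\<close>) and is attained by \<open>best_graph\<close> (\<open>best_graph_optimal\<close>).

  The function is convex only on \<open>{0..m}\<close>, but the graphs in the recurrence are compared for
  arbitrary \<open>d\<close> and \<open>e\<close>.  The upper bound is therefore proved for a globally convex extension, while
  the machine works with the supplied table, padded by zeros; both agree on all triples that matter,
  because \<open>d + e\<close> never exceeds \<open>m\<close> there (\<open>best_cong\<close>).

  The machine fills the table of \<open>best\<close> in three nested loops, in time \<open>O(n\<^sup>2 m)\<close>, and then follows
  the optimal choices from the triple \<open>(n, 0, m)\<close> down, writing out the star of each dominating
  vertex, in time \<open>O(n\<^sup>2)\<close>.\<close>

section \<open>Edge shifting\<close>

definition graph_on :: "nat set \<Rightarrow> nat set set \<Rightarrow> bool" where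
  "graph_on V E \<longleftrightarrow> (\<forall>e\<in>E. e \<subseteq> V \<and> card e = 2)"

lemma graph_on_subset_Pow: "graph_on V E \<Longrightarrow> E \<subseteq> Pow V"
  by (auto simp: graph_on_def)

lemma graph_on_finite: "finite V \<Longrightarrow> graph_on V E \<Longrightarrow> finite E"
  by (meson finite_Pow_iff finite_subset graph_on_subset_Pow)

lemma graph_on_notin: "graph_on V E \<Longrightarrow> b \<in> E \<Longrightarrow> x \<notin> V \<Longrightarrow> x \<notin> b"
  by (auto simp: graph_on_def subset_iff)

lemma card_graph_on_le:
  assumes "finite V" "graph_on V E"
  shows "card E \<le> card V choose 2"
proof -
  have "E \<subseteq> {e. e \<subseteq> V \<and> card e = 2}"
    using assms(2) by (auto simp: graph_on_def)
  then have "card E \<le> card {e. e \<subseteq> V \<and> card e = 2}"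
    using assms(1) by (intro card_mono) auto
  then show ?thesis
    using assms(1) by (simp add: n_subsets)
qed

lemma deg_insert:
  assumes "finite A" "e \<notin> A"
  shows "deg (insert e A) i = deg A i + (if i \<in> e then 1 else 0)"
proof -
  have "{b \<in> insert e A. i \<in> b} = (if i \<in> e then insert e {b \<in> A. i \<in> b} else {b \<in> A. i \<in> b})"
    by auto
  then show ?thesis
    using assms by (simp add: deg_def)
qed

lemma deg_le_card: "finite E \<Longrightarrow> deg E i \<le> card E"
  unfolding deg_def by (rule card_mono) auto

definition discretely_convex :: "(nat \<Rightarrow> real) \<Rightarrow> bool" where
  "discretely_convex h \<longleftrightarrow> (\<forall>t. 2 * h (Suc t) \<le> h t + h (Suc (Suc t)))"

lemma discretely_convex_increments:
  assumes "discretely_convex h" "b \<le> a"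
  shows "h (Suc b) + h a \<le> h b + h (Suc a)"
proof -
  have "h (Suc t) - h t \<le> h (Suc (Suc t)) - h (Suc t)" for t
    using assms(1)[unfolded discretely_convex_def, rule_format, of t] by simp
  from lift_Suc_mono_le[of "\<lambda>t. h (Suc t) - h t", OF this assms(2)] show ?thesis
    by simp
qed

lemma discretely_convex_shift:
  "discretely_convex h \<Longrightarrow> discretely_convex (\<lambda>t. h (d + t))"
  by (simp add: discretely_convex_def)

text \<open>The two sums are split in the same way, with a common remainder \<open>R\<close>, so that comparing them
  amounts to comparing two terms.  The codomain is general because the lemma serves both the real
  objective and the natural-valued sum of squares.\<close>

lemma sum_degrees_switch:
  fixes h :: "nat \<Rightarrow> 'a::comm_monoid_add"
  assumes "finite V" "finite A" "x \<in> V" "k \<in> V" "distinct [x, k, y]" "{k, y} \<notin> A" "{x, y} \<notin> A"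
  obtains R where
    "(\<Sum>i\<in>V. h (deg (insert {k, y} A) i)) = h (deg A x) + (h (Suc (deg A k)) + R)"
    "(\<Sum>i\<in>V. h (deg (insert {x, y} A) i)) = h (Suc (deg A x)) + (h (deg A k) + R)"
proof
  let ?R = "\<Sum>i\<in>V - {x} - {k}. h (deg (insert {k, y} A) i)"
  have V: "(\<Sum>i\<in>V. p i) = p x + (p k + (\<Sum>i\<in>V - {x} - {k}. p i))" for p :: "nat \<Rightarrow> 'a"
    using assms by (simp add: sum.remove[of V x] sum.remove[of "V - {x}" k])
  show "(\<Sum>i\<in>V. h (deg (insert {k, y} A) i)) = h (deg A x) + (h (Suc (deg A k)) + ?R)"
    using assms by (subst V) (simp add: deg_insert)
  have "(\<Sum>i\<in>V - {x} - {k}. h (deg (insert {x, y} A) i)) = ?R"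
    using assms by (intro sum.cong) (simp_all add: deg_insert)
  then show "(\<Sum>i\<in>V. h (deg (insert {x, y} A) i)) = h (Suc (deg A x)) + (h (deg A k) + ?R)"
    using assms by (subst V) (simp add: deg_insert)
qed

text \<open>The sum of squared degrees is the potential that makes repeated shifting terminate: a
  maximizer of it among all graphs at least as good as \<open>E\<close> replaces the induction over shifts.\<close>

lemma exists_dominating_or_isolated:
  assumes V: "finite V" "V \<noteq> {}" and E: "graph_on V E" and h: "discretely_convex h"
  obtains E' x where "graph_on V E'" "card E' = card E" "x \<in> V"
    "(\<Sum>i\<in>V. h (deg E i)) \<le> (\<Sum>i\<in>V. h (deg E' i))"
    "(\<forall>y\<in>V - {x}. {x, y} \<in> E') \<or> (\<forall>e\<in>E'. x \<notin> e)"
proof -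
  let ?better = "{E'. graph_on V E' \<and> card E' = card E \<and>
    (\<Sum>i\<in>V. h (deg E i)) \<le> (\<Sum>i\<in>V. h (deg E' i))}"
  let ?sq = "\<lambda>E'. \<Sum>i\<in>V. (deg E' i)\<^sup>2"
  have "?better \<subseteq> Pow (Pow V)"
    by (auto dest!: graph_on_subset_Pow)
  then have fin: "finite ?better"
    using V(1) by (simp add: finite_subset)
  have "?better \<noteq> {}"
    using E by blast
  then obtain E' where E': "E' \<in> ?better" and Max: "Max (?sq ` ?better) = ?sq E'"
    by (rule obtains_MAX[OF fin])
  have max: "?sq E'' \<le> ?sq E'" if "E'' \<in> ?better" for E''
    unfolding Max[symmetric] using fin that by (intro Max_ge finite_imageI imageI)
  have gE': "graph_on V E'" and finE': "finite E'"
    using E' V(1) graph_on_finite by blast+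
  obtain x where x: "x \<in> V" "\<And>k. k \<in> V \<Longrightarrow> deg E' k \<le> deg E' x"
    by (rule obtains_MAX[OF V, of "deg E'"]) (metis Max_ge V(1) finite_imageI imageI)
  \<comment> \<open>otherwise moving \<open>{k, y}\<close> to \<open>{x, y}\<close> would raise the sum of squares\<close>
  have absorb: "{x, y} \<in> E'" if ky: "{k, y} \<in> E'" "y \<noteq> x" "k \<noteq> x" for k y
  proof (rule ccontr)
    assume xy: "{x, y} \<notin> E'"
    have kyV: "k \<in> V" "y \<in> V" "k \<noteq> y"
      using gE' ky(1) by (fastforce simp: graph_on_def card_2_iff)+
    define A where "A = E' - {{k, y}}"
    have E'_eq: "E' = insert {k, y} A"
      using ky(1) by (auto simp: A_def)
    have A: "finite A" "{k, y} \<notin> A" "{x, y} \<notin> A" "distinct [x, k, y]"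
      using finE' xy ky kyV by (auto simp: A_def)
    have le: "Suc (deg A k) \<le> deg A x"
      using x(2)[OF kyV(1)] A unfolding E'_eq by (simp add: deg_insert)
    let ?E = "insert {x, y} A"
    have "graph_on V ?E"
      using gE' x(1) kyV ky(2) by (auto simp: graph_on_def A_def)
    moreover have "card ?E = card E"
      using E' A by (simp add: E'_eq)
    moreover have "(\<Sum>i\<in>V. h (deg E' i)) \<le> (\<Sum>i\<in>V. h (deg ?E i))"
      by (rule sum_degrees_switch[OF V(1) A(1) x(1) kyV(1) A(4,2,3), of h])
        (use discretely_convex_increments[OF h, of "deg A k" "deg A x"] le in \<open>simp add: E'_eq\<close>)
    ultimately have "?sq ?E \<le> ?sq E'"
      using E' by (intro max) auto
    moreover have "?sq E' < ?sq ?E"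
      by (rule sum_degrees_switch[OF V(1) A(1) x(1) kyV(1) A(4,2,3), of "\<lambda>t. t\<^sup>2"])
        (use le in \<open>simp add: E'_eq power2_eq_square\<close>)
    ultimately show False
      by simp
  qed
  have "\<exists>z\<in>V. (\<forall>y\<in>V - {z}. {z, y} \<in> E') \<or> (\<forall>e\<in>E'. z \<notin> e)"
  proof (cases "\<forall>y\<in>V - {x}. {x, y} \<in> E'")
    case True
    then show ?thesis using x(1) by blast
  next
    case False
    then obtain y where y: "y \<in> V" "y \<noteq> x" "{x, y} \<notin> E'"
      by blast
    \<comment> \<open>a neighbour \<open>k\<close> of \<open>y\<close> differs from \<open>x\<close>, so \<open>absorb\<close> would make \<open>y\<close> a neighbour of \<open>x\<close>\<close>
    have "y \<notin> e" if e: "e \<in> E'" for e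
    proof
      assume "y \<in> e"
      moreover obtain a b where "e = {a, b}"
        using gE' e by (auto simp: graph_on_def card_2_iff)
      ultimately obtain k where "e = {k, y}"
        by blast
      then show False
        using absorb[of k y] e y by metis
    qed
    then show ?thesis using y(1) by blast
  qed
  then show thesis
    using that[of E'] E' by blast
qed

section \<open>The recurrence\<close>

text \<open>For \<open>e \<le> r choose 2\<close> and convex \<open>f\<close> this is the maximum of the sum of \<open>f (d + deg E i)\<close> over the
  graphs \<open>E\<close> with \<open>e\<close> edges on \<open>r\<close> vertices.  With \<open>q\<close> further vertices, the next one can be
  dominating if \<open>q \<le> e\<close>, and isolated if \<open>e \<le> q choose 2\<close>, that is, if \<open>2 * e \<le> q * (q - 1)\<close>.  These two
  tests do the work of a value minus infinity for infeasible choices; when \<open>e \<le> Suc q choose 2\<close>, at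
  least one choice is feasible and only feasible ones are compared.  For larger \<open>e\<close> the value is
  meaningless and never reached from a feasible triple.\<close>

primrec best :: "(nat \<Rightarrow> real) \<Rightarrow> nat \<Rightarrow> nat \<Rightarrow> nat \<Rightarrow> real" where
  "best f 0 d e = 0"
| "best f (Suc q) d e =
    (let a = f (d + q) + best f q (Suc d) (e - q); b = f d + best f q d e
     in if q \<le> e \<and> (q * (q - 1) < 2 * e \<or> b \<le> a) then a else b)"

definition takes_dominating :: "(nat \<Rightarrow> real) \<Rightarrow> nat \<Rightarrow> nat \<Rightarrow> nat \<Rightarrow> bool" where
  "takes_dominating f q d e \<longleftrightarrow> q \<le> e \<and> (q * (q - 1) < 2 * e \<or>
     f d + best f q d e \<le> f (d + q) + best f q (Suc d) (e - q))"

lemma best_Suc: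
  "best f (Suc q) d e = (if takes_dominating f q d e
     then f (d + q) + best f q (Suc d) (e - q) else f d + best f q d e)"
  by (simp add: takes_dominating_def Let_def)

declare best.simps(2) [simp del]

lemma double_choose_two: "2 * (q choose 2) = q * (q - 1)"
  by (cases q) (simp_all add: choose_two)

lemma less_imp_le_choose_two:
  assumes "e < q"
  shows "e \<le> q choose 2"
proof -
  obtain p where "q = Suc p"
    using assms by (cases q) auto
  then have "2 * e \<le> 2 * (q choose 2)"
    using assms by (cases p) (auto simp: double_choose_two)
  then show ?thesis
    by simp
qed

text \<open>A dominating vertex is taken whenever more than \<open>q choose 2\<close> edges are left and \<open>q \<le> e\<close>.  If \<open>e < q\<close>,
  an isolated vertex is always possible, by \<open>less_imp_le_choose_two\<close>.\<close>

lemma feasible_step: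
  assumes "e \<le> Suc q choose 2"
  shows "takes_dominating f q d e \<Longrightarrow> q \<le> e \<and> e - q \<le> q choose 2"
    and "\<not> takes_dominating f q d e \<Longrightarrow> e \<le> q choose 2"
proof -
  have "Suc q choose 2 = q + (q choose 2)"
    by (simp add: numeral_2_eq_2)
  then show "takes_dominating f q d e \<Longrightarrow> q \<le> e \<and> e - q \<le> q choose 2"
    using assms by (simp add: takes_dominating_def)
  show "e \<le> q choose 2" if "\<not> takes_dominating f q d e"
  proof (cases "e < q")
    case False
    then show ?thesis
      using that double_choose_two[of q] by (auto simp: takes_dominating_def)
  qed (rule less_imp_le_choose_two)
qed

text \<open>The bound \<open>d + e \<le> m\<close> is preserved by both choices: a dominating vertex increases \<open>d\<close> by one and
  decreases \<open>e\<close> by \<open>q\<close>, and for \<open>q = 0\<close> the recursion ends with the value \<open>0\<close> anyway.  The arguments \<open>d\<close> and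
  \<open>d + q \<le> d + e\<close> at which the function is read are then at most \<open>m\<close>.\<close>

lemma best_cong:
  assumes "\<And>t. t \<le> m \<Longrightarrow> f t = g t" "d + e \<le> m"
  shows "best f r d e = best g r d e"
  using assms(2)
proof (induction r arbitrary: d e)
  case (Suc q)
  have b: "f d + best f q d e = g d + best g q d e"
    using Suc assms(1) by simp
  show ?case
  proof (cases "q \<le> e")
    case True
    have "best f q (Suc d) (e - q) = best g q (Suc d) (e - q)"
      using Suc True by (cases q) auto
    then show ?thesis
      using b True Suc.prems assms(1) by (simp add: best_Suc takes_dominating_def)
  next
    case False
    then show ?thesis
      using b by (simp add: best_Suc takes_dominating_def)
  qed
qed simp

text \<open>Deleting a vertex from a shifted graph may leave a graph to which further shifts apply.  Shifting
  is therefore done afresh at every level, and the induction runs over arbitrary graphs.\<close>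

lemma best_upper_bound:
  assumes "discretely_convex g" "finite V" "card V = r" "graph_on V E" "card E = e"
  shows "(\<Sum>i\<in>V. g (d + deg E i)) \<le> best g r d e"
  using assms(2-)
proof (induction r arbitrary: V E d e)
  case (Suc q)
  have "V \<noteq> {}"
    using Suc.prems by auto
  then obtain E' x where E': "graph_on V E'" "card E' = card E" and x: "x \<in> V"
    and better: "(\<Sum>i\<in>V. g (d + deg E i)) \<le> (\<Sum>i\<in>V. g (d + deg E' i))"
    and cases: "(\<forall>y\<in>V - {x}. {x, y} \<in> E') \<or> (\<forall>e\<in>E'. x \<notin> e)"
    using exists_dominating_or_isolated[OF Suc.prems(1) _ Suc.prems(3)
        discretely_convex_shift[OF assms(1), of d]] by metis
  let ?V = "V - {x}"
  let ?a = "g (d + q) + best g q (Suc d) (e - q)"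
  let ?b = "g d + best g q d e"
  have V: "finite ?V" "card ?V = q"
    using Suc.prems x by auto
  have finE': "finite E'"
    using E' Suc.prems(1) graph_on_finite by blast
  have split: "(\<Sum>i\<in>V. g (d + deg E' i)) = g (d + deg E' x) + (\<Sum>i\<in>?V. g (d + deg E' i))"
    using Suc.prems(1) x by (simp add: sum.remove)
  from cases have "(\<Sum>i\<in>V. g (d + deg E' i)) \<le> best g (Suc q) d e"
  proof
    assume dom: "\<forall>y\<in>?V. {x, y} \<in> E'"
    define R where "R = {b \<in> E'. x \<notin> b}"
    define S where "S = (\<lambda>y. {x, y}) ` ?V"
    have "{b \<in> E'. x \<in> b} = S"
    proof
      show "{b \<in> E'. x \<in> b} \<subseteq> S"
        using E'(1) by (fastforce simp: S_def graph_on_def card_2_iff)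
    qed (use dom in \<open>auto simp: S_def\<close>)
    then have E'_eq: "E' = R \<union> S" and deg_x: "deg E' x = card S"
      by (auto simp: R_def deg_def)
    have "inj_on (\<lambda>y. {x, y}) ?V"
      by (auto simp: inj_on_def doubleton_eq_iff)
    then have S: "card S = q" "finite S"
      using V by (simp_all add: S_def card_image)
    have disj: "R \<inter> S = {}" and finR: "finite R"
      using finE' by (auto simp: R_def S_def)
    have card: "e = card R + q"
      using E'(2) Suc.prems S disj finR by (simp add: E'_eq card_Un_disjoint)
    have deg: "deg E' i = Suc (deg R i)" if "i \<in> ?V" for i
    proof -
      have "{b \<in> E'. i \<in> b} = insert {x, i} {b \<in> R. i \<in> b}"
        using that by (auto simp: E'_eq S_def)
      moreover have "{x, i} \<notin> R"
        by (simp add: R_def)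
      ultimately show ?thesis
        using finR by (simp add: deg_def)
    qed
    have "graph_on ?V R"
      using E'(1) by (auto simp: graph_on_def R_def)
    then have "(\<Sum>i\<in>?V. g (Suc d + deg R i)) \<le> best g q (Suc d) (e - q)"
      using card by (intro Suc.IH V) auto
    then have "(\<Sum>i\<in>V. g (d + deg E' i)) \<le> ?a"
      using split deg deg_x S by simp
    then show ?thesis
      using card by (auto simp: best_Suc takes_dominating_def)
  next
    assume iso: "\<forall>e\<in>E'. x \<notin> e"
    then have R: "graph_on ?V E'"
      using E'(1) by (auto simp: graph_on_def)
    have "{b \<in> E'. x \<in> b} = {}"
      using iso by auto
    then have deg_x: "deg E' x = 0"
      by (simp only: deg_def card.empty)
    have "(\<Sum>i\<in>?V. g (d + deg E' i)) \<le> best g q d e"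
      using E'(2) Suc.prems by (intro Suc.IH V R) auto
    then have "(\<Sum>i\<in>V. g (d + deg E' i)) \<le> ?b"
      using split deg_x by simp
    moreover have "2 * e \<le> q * (q - 1)"
      using card_graph_on_le[OF V(1) R] V(2) E'(2) Suc.prems double_choose_two[of q] by auto
    ultimately show ?thesis
      by (auto simp: best_Suc takes_dominating_def)
  qed
  with better show ?case
    by simp
qed simp

text \<open>The second argument counts the edges of the star that have been written so far.\<close>

definition star :: "nat \<Rightarrow> nat \<Rightarrow> nat set set" where
  "star q j = (\<lambda>i. {Suc q, i}) ` {1..j}"

primrec best_graph :: "(nat \<Rightarrow> real) \<Rightarrow> nat \<Rightarrow> nat \<Rightarrow> nat \<Rightarrow> nat set set" where
  "best_graph f 0 d e = {}"
| "best_graph f (Suc q) d e = (if takes_dominating f q d e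
     then star q q \<union> best_graph f q (Suc d) (e - q) else best_graph f q d e)"

lemma best_graph_optimal:
  assumes "e \<le> r choose 2"
  shows "graph_on {1..r} (best_graph f r d e) \<and> card (best_graph f r d e) = e \<and>
    (\<Sum>i\<in>{1..r}. f (d + deg (best_graph f r d e) i)) = best f r d e"
  using assms
proof (induction r arbitrary: d e)
  case 0
  then show ?case by (simp add: graph_on_def numeral_2_eq_2)
next
  case (Suc q)
  have mono: "graph_on {1..Suc q} G" if "graph_on {1..q} G" for G
    using that by (fastforce simp: graph_on_def)
  show ?case
  proof (cases "takes_dominating f q d e")
    case False
    let ?G = "best_graph f q d e"
    have IH: "graph_on {1..q} ?G" "card ?G = e" "(\<Sum>i\<in>{1..q}. f (d + deg ?G i)) = best f q d e"
      using Suc.IH[of e d] feasible_step(2)[OF Suc.prems False] by auto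
    have "Suc q \<notin> b" if "b \<in> ?G" for b
      using graph_on_notin[OF IH(1) that, of "Suc q"] by simp
    then have "{b \<in> ?G. Suc q \<in> b} = {}"
      by auto
    then have "deg ?G (Suc q) = 0"
      by (simp only: deg_def card.empty)
    then show ?thesis
      using IH mono False by (simp add: best_Suc)
  next
    case True
    let ?G = "best_graph f q (Suc d) (e - q)"
    have e: "q \<le> e" "e - q \<le> q choose 2"
      using feasible_step(1)[OF Suc.prems True] by auto
    then have IH: "graph_on {1..q} ?G" "card ?G = e - q"
      "(\<Sum>i\<in>{1..q}. f (Suc d + deg ?G i)) = best f q (Suc d) (e - q)"
      using Suc.IH[of "e - q" "Suc d"] by auto
    have finG: "finite ?G"
      by (rule graph_on_finite[OF _ IH(1)]) simp
    have notin: "Suc q \<notin> b" if "b \<in> ?G" for b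
      using graph_on_notin[OF IH(1) that, of "Suc q"] by simp
    have "inj_on (\<lambda>i. {Suc q, i}) {1..q}"
      by (auto simp: inj_on_def doubleton_eq_iff)
    then have star: "card (star q q) = q" "finite (star q q)"
      by (simp_all add: star_def card_image)
    have disj: "star q q \<inter> ?G = {}"
      using notin by (auto simp: star_def)
    have graph: "graph_on {1..Suc q} (star q q \<union> ?G)"
      using mono[OF IH(1)] by (auto simp: graph_on_def star_def)
    have "{b \<in> star q q \<union> ?G. Suc q \<in> b} = star q q"
      using notin by (auto simp: star_def)
    then have deg_top: "deg (star q q \<union> ?G) (Suc q) = q"
      using star by (simp add: deg_def)
    have deg_rest: "deg (star q q \<union> ?G) i = Suc (deg ?G i)" if i: "i \<in> {1..q}" for i
    proof -
      have "{b \<in> star q q \<union> ?G. i \<in> b} = insert {Suc q, i} {b \<in> ?G. i \<in> b}"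
      proof -
        have "b \<in> star q q \<and> i \<in> b \<longleftrightarrow> b = {Suc q, i}" for b
          using i by (auto simp: star_def)
        then show ?thesis
          by blast
      qed
      moreover have "{Suc q, i} \<notin> ?G"
        using notin[of "{Suc q, i}"] by auto
      ultimately show ?thesis
        using finG by (simp add: deg_def)
    qed
    have "(\<Sum>i\<in>{1..q}. f (d + deg (star q q \<union> ?G) i)) = best f q (Suc d) (e - q)"
      unfolding IH(3)[symmetric] by (intro sum.cong) (simp_all add: deg_rest)
    then show ?thesis
      using True graph deg_top IH(2) star finG disj e(1)
      by (simp add: best_Suc card_Un_disjoint)
  qed
qed

text \<open>\<open>F\<close> is the value table as the machine sees it, with arbitrary values beyond \<open>m\<close>.  Optimality is
  shown for the convex extension \<open>h\<close> and carried over, since degrees are at most \<open>m\<close>.\<close>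

lemma maximizes_best_graph:
  assumes f: "convex_upto m f" and m: "m \<le> n choose 2" and F: "\<And>t. t \<le> m \<Longrightarrow> F t = f t"
  shows "maximizes_degree_sum n m f (best_graph F n 0 m)"
proof -
  obtain g :: "real \<Rightarrow> real" where g: "convex_on UNIV g" "\<And>t. t \<le> m \<Longrightarrow> f t = g (real t)"
    using f by (auto simp: convex_upto_def)
  define h where "h t = g (real t)" for t :: nat
  have "2 * h (Suc t) \<le> h t + h (Suc (Suc t))" for t
    using convex_onD[OF g(1), of "1/2" "real t" "real t + 2"]
    by (simp add: h_def algebra_simps)
  then have convex: "discretely_convex h"
    by (simp add: discretely_convex_def)
  have small: "f (deg E i) = h (deg E i)" "f (deg E i) = F (deg E i)"
    if "graph_on {1..n} E" "card E = m" for E i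
    using deg_le_card[of E i] that graph_on_finite[of "{1..n}" E] g(2) F by (auto simp: h_def)
  have best: "best h n 0 m = best F n 0 m"
    by (rule best_cong[of m]) (simp_all add: F g(2) h_def)
  let ?G = "best_graph F n 0 m"
  have G: "graph_on {1..n} ?G" "card ?G = m"
    and G_sum: "(\<Sum>i\<in>{1..n}. F (deg ?G i)) = best F n 0 m"
    using best_graph_optimal[OF m, of F 0] by auto
  have "(\<Sum>i\<in>{1..n}. f (deg E i)) \<le> (\<Sum>i\<in>{1..n}. f (deg ?G i))"
    if E: "graph_on {1..n} E" "card E = m" for E
    using best_upper_bound[OF convex, of "{1..n}" n E m 0] E small(1)[OF E] small(2)[OF G] best G_sum
    by simp
  then show ?thesis
    using G by (simp add: maximizes_degree_sum_def simple_graph_def graph_on_def)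
qed

section \<open>Running times of programs\<close>

definition runs_within :: "com \<Rightarrow> store \<Rightarrow> nat \<Rightarrow> (store \<Rightarrow> bool) \<Rightarrow> bool" where
  "runs_within c s T Q \<longleftrightarrow> (\<exists>t s'. runs c s t s' \<and> t \<le> T \<and> Q s')"

lemma runs_within_mono:
  "runs_within c s T P \<Longrightarrow> T \<le> T' \<Longrightarrow> (\<And>s'. P s' \<Longrightarrow> Q s') \<Longrightarrow> runs_within c s T' Q"
  unfolding runs_within_def by (meson le_trans)

lemma runs_within_Skip: "Q s \<Longrightarrow> runs_within Skip s 1 Q"
  unfolding runs_within_def using runs.Skip by blast

lemma runs_within_NAssign:
  "Q (nupdate x (nval s a) (nval s b) s) \<Longrightarrow> runs_within (NAssign x a b) s (1 + ncost a + ncost b) Q"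
  unfolding runs_within_def using runs.NAssign by blast

lemma runs_within_RAssign:
  "Q (rupdate x (nval s a) (rval s b) s) \<Longrightarrow> runs_within (RAssign x a b) s (1 + ncost a + rcost b) Q"
  unfolding runs_within_def using runs.RAssign by blast

lemma runs_within_Seq:
  assumes "runs_within c s T P" "\<And>s'. P s' \<Longrightarrow> runs_within d s' U Q"
  shows "runs_within (Seq c d) s (1 + T + U) Q"
proof -
  obtain t s' where c: "runs c s t s'" "t \<le> T" "P s'"
    using assms(1) by (auto simp: runs_within_def)
  obtain u s'' where d: "runs d s' u s''" "u \<le> U" "Q s''"
    using assms(2)[OF c(3)] by (auto simp: runs_within_def)
  have "1 + t + u \<le> 1 + T + U"
    using c(2) d(2) by simp
  then show ?thesis
    unfolding runs_within_def using runs.Seq[OF c(1) d(1)] d(3) by blast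
qed

lemma runs_within_NAssign_Seq:
  "runs_within d (nupdate x (nval s a) (nval s b) s) U Q \<Longrightarrow>
    runs_within (Seq (NAssign x a b) d) s (2 + ncost a + ncost b + U) Q"
  using runs_within_Seq[OF runs_within_NAssign[of "\<lambda>s'. s' = nupdate x (nval s a) (nval s b) s", OF refl],
      of d U Q] by simp

lemma runs_within_Cond:
  assumes "bval s p \<Longrightarrow> runs_within c s T Q" "\<not> bval s p \<Longrightarrow> runs_within d s T Q"
  shows "runs_within (Cond p c d) s (1 + bcost p + T) Q"
proof (cases "bval s p")
  case True
  then obtain t s' where "runs c s t s'" "t \<le> T" "Q s'"
    using assms(1) by (auto simp: runs_within_def)
  then show ?thesis
    unfolding runs_within_def using runs.CondTrue[OF True] by (meson add_le_mono le_refl)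
next
  case False
  then obtain t s' where "runs d s t s'" "t \<le> T" "Q s'"
    using assms(2) by (auto simp: runs_within_def)
  then show ?thesis
    unfolding runs_within_def using runs.CondFalse[OF False] by (meson add_le_mono le_refl)
qed

text \<open>The invariant is indexed by the number of completed iterations, so one rule gives termination,
  the bound on the running time and the final state.\<close>

lemma runs_within_While:
  assumes start: "I 0 s"
    and step: "\<And>i s. i < N \<Longrightarrow> I i s \<Longrightarrow> bval s p \<and> runs_within c s T (I (Suc i))"
    and stop: "\<And>s. I N s \<Longrightarrow> \<not> bval s p"
  shows "runs_within (While p c) s (N * (T + 1 + bcost p) + 1 + bcost p) (I N)"
proof -
  have "runs_within (While p c) s (k * (T + 1 + bcost p) + 1 + bcost p) (I N)"
    if "k \<le> N" "I (N - k) s" for k s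
    using that
  proof (induction k arbitrary: s)
    case 0
    then show ?case
      unfolding runs_within_def using runs.WhileFalse[OF stop] by (intro exI[of _ "1 + bcost p"] exI) auto
  next
    case (Suc k)
    have less: "N - Suc k < N" and next_index: "Suc (N - Suc k) = N - k"
      using Suc.prems(1) by auto
    obtain t s' where c: "bval s p" "runs c s t s'" "t \<le> T" "I (N - k) s'"
      using step[OF less Suc.prems(2)] by (auto simp: runs_within_def next_index)
    obtain u s'' where w: "runs (While p c) s' u s''" "u \<le> k * (T + 1 + bcost p) + 1 + bcost p" "I N s''"
      using Suc.IH[of s'] Suc.prems(1) c(4) by (auto simp: runs_within_def)
    have "1 + bcost p + t + u \<le> Suc k * (T + 1 + bcost p) + 1 + bcost p"
      using c(3) w(2) by simp
    then show ?case
      unfolding runs_within_def using runs.WhileTrue[OF c(1,2) w(1)] w(3) by blast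
  qed
  from this[of N s] start show ?thesis
    by simp
qed

section \<open>The program\<close>

abbreviation var :: "string \<Rightarrow> nexp" where
  "var x \<equiv> NCell x (NConst 0)"

abbreviation set_var :: "string \<Rightarrow> nexp \<Rightarrow> com" where
  "set_var x a \<equiv> NAssign x (NConst 0) a"

text \<open>Mixed-radix encoding of a triple with \<open>d \<le> n\<close> and \<open>e \<le> m\<close>; computing it needs no division.\<close>

definition table_index :: "nat \<Rightarrow> nat \<Rightarrow> nat \<Rightarrow> nat \<Rightarrow> nat \<Rightarrow> nat" where
  "table_index n m q d e = (q * (n + 1) + d) * (m + 1) + e"

lemma table_index_inject:
  assumes "d \<le> n" "e \<le> m" "d' \<le> n" "e' \<le> m"
  shows "table_index n m q d e = table_index n m q' d' e' \<longleftrightarrow> q = q' \<and> d = d' \<and> e = e'"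
proof
  assume eq: "table_index n m q d e = table_index n m q' d' e'"
  have digits: "(a * (k + 1) + b) div (k + 1) = a \<and> (a * (k + 1) + b) mod (k + 1) = b"
    if "b \<le> k" for a b k :: nat
    unfolding div_mult_self3 mod_mult_self3 using that by (simp del: One_nat_def add_Suc_right)
  have "e = e'" "q * (n + 1) + d = q' * (n + 1) + d'"
    using digits[OF assms(2)] digits[OF assms(4)] eq unfolding table_index_def by metis+
  then show "q = q' \<and> d = d' \<and> e = e'"
    using digits[OF assms(1)] digits[OF assms(3)] by metis
qed simp

definition index_exp :: "nexp \<Rightarrow> nexp \<Rightarrow> nexp \<Rightarrow> nexp" where
  "index_exp q d e = NAdd (NMul (NAdd (NMul q (NAdd (var ''n'') (NConst 1))) d)
     (NAdd (var ''m'') (NConst 1))) e"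

text \<open>Throughout, the variable \<open>q\<close> holds the number of vertices that remain after the current one, so
  the entry for \<open>Suc q\<close> vertices is computed from entries for \<open>q\<close> vertices.  The same test
  \<open>dominating_test\<close> serves to fill the table and to follow the choices afterwards.\<close>

definition dominating_value :: rexp where
  "dominating_value = RAdd (RCell ''f'' (NAdd (var ''d'') (var ''q'')))
     (RCell ''W'' (index_exp (var ''q'') (NAdd (var ''d'') (NConst 1)) (NSub (var ''e'') (var ''q''))))"

definition isolated_value :: rexp where
  "isolated_value = RAdd (RCell ''f'' (var ''d''))
     (RCell ''W'' (index_exp (var ''q'') (var ''d'') (var ''e'')))"

definition dominating_test :: bexp where
  "dominating_test = BAnd (BNot (NLess (var ''e'') (var ''q'')))
     (BNot (BAnd
       (BNot (NLess (NMul (var ''q'') (NSub (var ''q'') (NConst 1))) (NMul (NConst 2) (var ''e''))))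
       (RLess dominating_value isolated_value)))"

definition fill_cell :: com where
  "fill_cell = (let i = index_exp (NAdd (var ''q'') (NConst 1)) (var ''d'') (var ''e'')
     in Cond dominating_test (RAssign ''W'' i dominating_value) (RAssign ''W'' i isolated_value))"

definition increment :: "string \<Rightarrow> com" where
  "increment x = set_var x (NAdd (var x) (NConst 1))"

text \<open>A row has fixed \<open>q\<close> and \<open>d\<close>; a layer has fixed \<open>q\<close>.\<close>

definition fill_row :: com where
  "fill_row = While (NLess (var ''e'') (NAdd (var ''m'') (NConst 1)))
     (Seq fill_cell (increment ''e''))"

definition fill_layer :: com where
  "fill_layer = While (NLess (var ''d'') (NSub (var ''n'') (var ''q'')))
     (Seq (set_var ''e'' (NConst 0)) (Seq fill_row (increment ''d'')))"

definition fill_table :: com where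
  "fill_table = While (NLess (var ''q'') (var ''n''))
     (Seq (set_var ''d'' (NConst 0)) (Seq fill_layer (increment ''q'')))"

definition emit_star :: com where
  "emit_star = While (NLess (var ''j'') (var ''q''))
     (Seq (NAssign ''u'' (var ''k'') (NAdd (var ''q'') (NConst 1)))
     (Seq (NAssign ''v'' (var ''k'') (NAdd (var ''j'') (NConst 1)))
     (Seq (increment ''k'') (increment ''j''))))"

definition emit_dominating :: com where
  "emit_dominating = Seq (set_var ''d'' (NAdd (var ''d'') (NConst 1)))
     (Seq (set_var ''e'' (NSub (var ''e'') (var ''q''))) (Seq (set_var ''j'' (NConst 0)) emit_star))"

definition emit_vertex :: com where
  "emit_vertex = Seq (set_var ''q'' (NSub (var ''q'') (NConst 1)))
     (Cond dominating_test emit_dominating Skip)"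

definition emit_graph :: com where
  "emit_graph = While (NLess (NConst 0) (var ''q'')) emit_vertex"

definition optimizer :: com where
  "optimizer = Seq fill_table
     (Seq (set_var ''d'' (NConst 0)) (Seq (set_var ''e'' (var ''m''))
     (Seq (set_var ''k'' (NConst 0)) emit_graph)))"

lemma nats_nupdate [simp]:
  "nats (nupdate x i v s) y j = (if y = x \<and> j = i then v else nats s y j)"
  by (simp add: nupdate_def)

lemma reals_nupdate [simp]: "reals (nupdate x i v s) = reals s"
  by (simp add: nupdate_def)

lemma nats_rupdate [simp]: "nats (rupdate x i v s) = nats s"
  by (simp add: rupdate_def)

lemma reals_rupdate [simp]:
  "reals (rupdate x i v s) y j = (if y = x \<and> j = i then v else reals s y j)"
  by (simp add: rupdate_def)

section \<open>Filling the table\<close>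

definition holds_input :: "nat \<Rightarrow> nat \<Rightarrow> (nat \<Rightarrow> real) \<Rightarrow> store \<Rightarrow> bool" where
  "holds_input n m F s \<longleftrightarrow> nats s ''n'' 0 = n \<and> nats s ''m'' 0 = m \<and> (\<forall>t. reals s ''f'' t = F t)"

text \<open>All entries that lexicographically precede \<open>(q, d, e)\<close> are correct, as far as they lie in the
  region \<open>d' + q' \<le> n\<close>, \<open>e' \<le> m\<close>.  At most \<open>n - q'\<close> dominating vertices have been deleted when \<open>q'\<close>
  vertices are left, so this region suffices; it is closed under the recurrence.  With this order
  the end of a row or of a layer is a mere change of the triple (\<open>filled_next_row\<close>,
  \<open>filled_next_layer\<close>).\<close>

definition filled :: "nat \<Rightarrow> nat \<Rightarrow> (nat \<Rightarrow> real) \<Rightarrow> nat \<Rightarrow> nat \<Rightarrow> nat \<Rightarrow> store \<Rightarrow> bool" where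
  "filled n m F q d e s \<longleftrightarrow> holds_input n m F s \<and>
     (\<forall>q' d' e'. d' + q' \<le> n \<and> e' \<le> m \<and> (q' < q \<or> q' = q \<and> (d' < d \<or> d' = d \<and> e' < e)) \<longrightarrow>
        reals s ''W'' (table_index n m q' d' e') = best F q' d' e')"

lemma filled_nupdate [simp]:
  "x \<noteq> ''n'' \<Longrightarrow> x \<noteq> ''m'' \<Longrightarrow> filled n m F q d e (nupdate x i v s) = filled n m F q d e s"
  by (simp add: filled_def holds_input_def)

lemma filled_best:
  "filled n m F q d e s \<Longrightarrow> q' < q \<Longrightarrow> d' + q' \<le> n \<Longrightarrow> e' \<le> m \<Longrightarrow>
    reals s ''W'' (table_index n m q' d' e') = best F q' d' e'"
  by (simp add: filled_def)

lemma index_exp_value: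
  "filled n m F q d e s \<Longrightarrow> nval s (index_exp a b c) = table_index n m (nval s a) (nval s b) (nval s c)"
  by (simp add: filled_def holds_input_def index_exp_def table_index_def)

definition counters :: "nat \<Rightarrow> nat \<Rightarrow> nat \<Rightarrow> store \<Rightarrow> bool" where
  "counters q d e s \<longleftrightarrow> nats s ''q'' 0 = q \<and> nats s ''d'' 0 = d \<and> nats s ''e'' 0 = e"

lemma choice_values:
  assumes "filled n m F q' d' e' s" "counters q d e s" "q < q'" "d + q < n" "e \<le> m"
  shows "rval s dominating_value = F (d + q) + best F q (Suc d) (e - q)"
    and "rval s isolated_value = F d + best F q d e"
    and "bval s dominating_test \<longleftrightarrow> takes_dominating F q d e"
proof -
  have f: "reals s ''f'' t = F t" for t
    using assms(1) by (simp add: filled_def holds_input_def)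
  show dom: "rval s dominating_value = F (d + q) + best F q (Suc d) (e - q)"
    using assms filled_best[OF assms(1,3), of "Suc d" "e - q"]
    by (simp add: dominating_value_def index_exp_value f counters_def)
  show iso: "rval s isolated_value = F d + best F q d e"
    using assms filled_best[OF assms(1,3), of d e]
    by (simp add: isolated_value_def index_exp_value f counters_def)
  show "bval s dominating_test \<longleftrightarrow> takes_dominating F q d e"
    using assms(2) by (auto simp: dominating_test_def takes_dominating_def dom iso counters_def)
qed

lemma filled_rupdate:
  assumes "filled n m F (Suc q) d e s" "d + q < n" "e \<le> m"
  shows "filled n m F (Suc q) d (Suc e)
    (rupdate ''W'' (table_index n m (Suc q) d e) (best F (Suc q) d e) s)"
  using assms by (auto simp: filled_def holds_input_def table_index_inject less_Suc_eq)

text \<open>The number 200, like the constants in the later time bounds, comes from adding up the unit costs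
  in the program text and rounding up.\<close>

lemma fill_cell:
  assumes "filled n m F (Suc q) d e s" "counters q d e s" "d + q < n" "e \<le> m"
  shows "runs_within fill_cell s 200
    (\<lambda>s'. filled n m F (Suc q) d (Suc e) s' \<and> counters q d e s')"
proof -
  have i: "nval s (index_exp (NAdd (var ''q'') (NConst 1)) (var ''d'') (var ''e'')) = table_index n m (Suc q) d e"
    using assms(2) by (simp add: index_exp_value[OF assms(1)] counters_def)
  note choice = choice_values[OF assms(1,2) lessI assms(3,4)]
  have costs: "1 + ncost (index_exp (NAdd (var ''q'') (NConst 1)) (var ''d'') (var ''e'')) + rcost r \<le> 60"
    if "r \<in> {dominating_value, isolated_value}" for r
    using that by (auto simp: dominating_value_def isolated_value_def index_exp_def)
  show ?thesis
    unfolding fill_cell_def Let_def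
  proof (rule runs_within_mono[OF runs_within_Cond[where T = 60]])
    let ?Q = "\<lambda>s'. filled n m F (Suc q) d (Suc e) s' \<and> counters q d e s'"
    show "runs_within (RAssign ''W'' (index_exp (NAdd (var ''q'') (NConst 1)) (var ''d'') (var ''e''))
        dominating_value) s 60 ?Q" if "bval s dominating_test"
      by (rule runs_within_mono[OF runs_within_RAssign[where Q = ?Q] costs])
        (use that filled_rupdate[OF assms(1,3,4)] assms(2) in
          \<open>simp_all add: i[unfolded One_nat_def] choice best_Suc counters_def\<close>)
    show "runs_within (RAssign ''W'' (index_exp (NAdd (var ''q'') (NConst 1)) (var ''d'') (var ''e''))
        isolated_value) s 60 ?Q" if "\<not> bval s dominating_test"
      by (rule runs_within_mono[OF runs_within_RAssign[where Q = ?Q] costs])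
        (use that filled_rupdate[OF assms(1,3,4)] assms(2) in
          \<open>simp_all add: i[unfolded One_nat_def] choice best_Suc counters_def\<close>)
  qed (simp_all add: dominating_test_def dominating_value_def isolated_value_def index_exp_def)
qed

lemma filled_sizes:
  assumes "filled n m F q d e s"
  shows "nats s ''n'' 0 = n" "nats s ''m'' 0 = m"
  using assms by (simp_all add: filled_def holds_input_def)

lemma filled_next_row: "filled n m F q d (Suc m) s \<Longrightarrow> filled n m F q (Suc d) 0 s"
  by (auto simp: filled_def less_Suc_eq le_less)

lemma filled_next_layer: "n < q + d \<Longrightarrow> filled n m F q d 0 s \<Longrightarrow> filled n m F (Suc q) 0 0 s"
  by (auto simp: filled_def less_Suc_eq)

lemma fill_row:
  assumes "filled n m F (Suc q) d 0 s" "counters q d 0 s" "d + q < n"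
  shows "runs_within fill_row s ((m + 1) * 215 + 8)
    (\<lambda>s'. filled n m F (Suc q) (Suc d) 0 s' \<and> (\<exists>e. counters q d e s'))"
proof -
  let ?I = "\<lambda>e s. filled n m F (Suc q) d e s \<and> counters q d e s"
  have body: "runs_within (Seq fill_cell (increment ''e'')) s' 207 (?I (Suc e))"
    if "e \<le> m" "?I e s'" for e s'
  proof -
    have inc: "runs_within (increment ''e'') s'' 6 (?I (Suc e))"
      if "filled n m F (Suc q) d (Suc e) s'' \<and> counters q d e s''" for s''
      unfolding increment_def
      by (rule runs_within_mono[OF runs_within_NAssign[where Q = "?I (Suc e)"]])
        (use that in \<open>auto simp: counters_def\<close>)
    show ?thesis
      by (rule runs_within_mono[OF runs_within_Seq[OF fill_cell inc]]) (use that assms(3) in auto)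
  qed
  show ?thesis
    unfolding fill_row_def
  proof (rule runs_within_mono[OF runs_within_While[where I = ?I and N = "m + 1" and T = 207]])
    show "bval s' (NLess (var ''e'') (NAdd (var ''m'') (NConst 1))) \<and>
        runs_within (Seq fill_cell (increment ''e'')) s' 207 (?I (Suc e))"
      if "e < m + 1" "?I e s'" for e s'
      using that body[of e s'] filled_sizes[of n m F "Suc q" d e s'] by (simp add: counters_def)
    show "\<not> bval s' (NLess (var ''e'') (NAdd (var ''m'') (NConst 1)))" if "?I (m + 1) s'" for s'
      using that filled_sizes[of n m F "Suc q" d "m + 1" s'] by (simp add: counters_def)
  qed (use assms filled_next_row in auto)
qed

lemma fill_layer:
  assumes "filled n m F (Suc q) 0 0 s" "counters q 0 e s" "q < n"
  shows "runs_within fill_layer s ((n - q) * ((m + 1) * 215 + 28) + 9)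
    (\<lambda>s'. filled n m F (Suc (Suc q)) 0 0 s' \<and> nats s' ''q'' 0 = q)"
proof -
  let ?I = "\<lambda>d s. filled n m F (Suc q) d 0 s \<and> (\<exists>e. counters q d e s)"
  let ?body = "Seq (set_var ''e'' (NConst 0)) (Seq fill_row (increment ''d''))"
  let ?T = "(m + 1) * 215 + 19"
  have body: "runs_within ?body s' ?T (?I (Suc d))" if "d + q < n" "?I d s'" for d s'
  proof -
    have "runs_within (increment ''d'') s'' 6 (?I (Suc d))"
      if "filled n m F (Suc q) (Suc d) 0 s'' \<and> (\<exists>e. counters q d e s'')" for s''
      unfolding increment_def
      by (rule runs_within_mono[OF runs_within_NAssign[where Q = "?I (Suc d)"]])
        (use that in \<open>auto simp: counters_def\<close>)
    note row = runs_within_Seq[OF fill_row this]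
    show ?thesis
      by (rule runs_within_mono[OF runs_within_NAssign_Seq[OF row]])
        (use that in \<open>auto simp: counters_def\<close>)
  qed
  show ?thesis
    unfolding fill_layer_def
  proof (rule runs_within_mono[OF runs_within_While[where I = ?I and N = "n - q" and T = ?T]])
    show "bval s' (NLess (var ''d'') (NSub (var ''n'') (var ''q''))) \<and>
        runs_within ?body s' ?T (?I (Suc d))"
      if "d < n - q" "?I d s'" for d s'
      using that body[of d s'] filled_sizes[of n m F "Suc q" d 0 s'] by (auto simp: counters_def)
    show "\<not> bval s' (NLess (var ''d'') (NSub (var ''n'') (var ''q'')))" if "?I (n - q) s'" for s'
      using that filled_sizes[of n m F "Suc q" "n - q" 0 s'] by (auto simp: counters_def)
  qed (use assms filled_next_layer[of n "Suc q" "n - q"] in \<open>auto simp: counters_def\<close>)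
qed

lemma fill_table:
  assumes "filled n m F 1 0 0 s" "nats s ''q'' 0 = 0"
  shows "runs_within fill_table s (n * (n * ((m + 1) * 215 + 28) + 26) + 6)
    (\<lambda>s'. filled n m F (Suc n) 0 0 s' \<and> nats s' ''q'' 0 = n)"
proof -
  let ?I = "\<lambda>q s. filled n m F (Suc q) 0 0 s \<and> nats s ''q'' 0 = q"
  let ?body = "Seq (set_var ''d'' (NConst 0)) (Seq fill_layer (increment ''q''))"
  let ?L = "n * ((m + 1) * 215 + 28) + 9"
  have body: "runs_within ?body s' (?L + 11) (?I (Suc q))" if "q < n" "?I q s'" for q s'
  proof -
    have inc: "runs_within (increment ''q'') s'' 6 (?I (Suc q))"
      if "filled n m F (Suc (Suc q)) 0 0 s'' \<and> nats s'' ''q'' 0 = q" for s''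
      unfolding increment_def
      by (rule runs_within_mono[OF runs_within_NAssign[where Q = "?I (Suc q)"]]) (use that in auto)
    have "filled n m F (Suc q) 0 0 (nupdate ''d'' 0 0 s')"
      "counters q 0 (nats s' ''e'' 0) (nupdate ''d'' 0 0 s')"
      using that by (simp_all add: counters_def)
    from fill_layer[OF this that(1)]
    have "runs_within fill_layer (nupdate ''d'' 0 0 s') ?L
        (\<lambda>s'. filled n m F (Suc (Suc q)) 0 0 s' \<and> nats s' ''q'' 0 = q)"
      by (rule runs_within_mono) simp_all
    from runs_within_Seq[OF this inc] show ?thesis
      by (intro runs_within_mono[OF runs_within_NAssign_Seq]) auto
  qed
  show ?thesis
    unfolding fill_table_def
  proof (rule runs_within_mono[OF runs_within_While[where I = ?I and N = n and T = "?L + 11"]])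
    show "bval s' (NLess (var ''q'') (var ''n'')) \<and> runs_within ?body s' (?L + 11) (?I (Suc q))"
      if "q < n" "?I q s'" for q s'
      using that body[of q s'] filled_sizes[of n m F "Suc q" 0 0 s'] by auto
    show "\<not> bval s' (NLess (var ''q'') (var ''n''))" if "?I n s'" for s'
      using that filled_sizes[of n m F "Suc n" 0 0 s'] by auto
  qed (use assms in auto)
qed

section \<open>Reading off the graph\<close>

lemma output_edges_0 [simp]: "output_edges 0 s = {}"
  by (simp add: output_edges_def)

lemma output_edges_Suc:
  "output_edges (Suc k) s = insert {nats s ''u'' k, nats s ''v'' k} (output_edges k s)"
  by (simp add: output_edges_def lessThan_Suc)

lemma output_edges_nupdate [simp]:
  "(x \<noteq> ''u'' \<and> x \<noteq> ''v'') \<or> k \<le> i \<Longrightarrow> output_edges k (nupdate x i a s) = output_edges k s"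
  by (auto simp: output_edges_def intro!: image_cong)

lemma star_0 [simp]: "star q 0 = {}"
  by (simp add: star_def)

lemma star_Suc: "star q (Suc j) = insert {Suc q, Suc j} (star q j)"
  by (simp add: star_def atLeastAtMostSuc_conv)

lemma emit_star:
  assumes "filled n m F (Suc n) 0 0 s" "counters q d e s" "nats s ''j'' 0 = 0" "nats s ''k'' 0 = k"
  shows "runs_within emit_star s (q * 35 + 6)
    (\<lambda>s'. filled n m F (Suc n) 0 0 s' \<and> counters q d e s' \<and> nats s' ''k'' 0 = k + q \<and>
       output_edges (k + q) s' = output_edges k s \<union> star q q)"
proof -
  let ?I = "\<lambda>j s'. filled n m F (Suc n) 0 0 s' \<and> counters q d e s' \<and> nats s' ''j'' 0 = j \<and>
    nats s' ''k'' 0 = k + j \<and> output_edges (k + j) s' = output_edges k s \<union> star q j"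
  let ?body = "Seq (NAssign ''u'' (var ''k'') (NAdd (var ''q'') (NConst 1)))
     (Seq (NAssign ''v'' (var ''k'') (NAdd (var ''j'') (NConst 1)))
     (Seq (increment ''k'') (increment ''j'')))"
  have body: "runs_within ?body s' 29 (?I (Suc j))" if "?I j s'" for j s'
    unfolding increment_def
    by (rule runs_within_mono[OF runs_within_NAssign_Seq[OF runs_within_NAssign_Seq[OF runs_within_NAssign_Seq[OF
              runs_within_NAssign[where Q = "?I (Suc j)"]]]]])
      (use that in \<open>auto simp: counters_def output_edges_Suc star_Suc\<close>)
  show ?thesis
    unfolding emit_star_def
  proof (rule runs_within_mono[OF runs_within_While[where I = ?I and N = q and T = 29]])
    show "bval s' (NLess (var ''j'') (var ''q'')) \<and> runs_within ?body s' 29 (?I (Suc j))"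
      if "j < q" "?I j s'" for j s'
      using that body[of s' j] by (simp add: counters_def)
  qed (use assms in \<open>auto simp: counters_def\<close>)
qed

text \<open>With \<open>r\<close> vertices left, the edges written so far complete the optimal graph for the current
  triple to the optimal graph of the whole problem.\<close>

definition emitting :: "nat \<Rightarrow> nat \<Rightarrow> (nat \<Rightarrow> real) \<Rightarrow> nat \<Rightarrow> store \<Rightarrow> bool" where
  "emitting n m F r s \<longleftrightarrow> filled n m F (Suc n) 0 0 s \<and>
     (\<exists>d e k. counters r d e s \<and> nats s ''k'' 0 = k \<and> d + r \<le> n \<and> e \<le> r choose 2 \<and> k + e = m \<and>
        output_edges k s \<union> best_graph F r d e = best_graph F n 0 m)"

lemma emittingI:
  assumes "filled n m F (Suc n) 0 0 s" "counters r d e s" "nats s ''k'' 0 = k"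
    "d + r \<le> n" "e \<le> r choose 2" "k + e = m"
    "output_edges k s \<union> best_graph F r d e = best_graph F n 0 m"
  shows "emitting n m F r s"
  using assms unfolding emitting_def by blast

lemma emit_vertex:
  assumes "emitting n m F (Suc q) s"
  shows "runs_within emit_vertex s (35 * n + 150) (emitting n m F q)"
proof -
  obtain d e k where fill: "filled n m F (Suc n) 0 0 s" and count: "counters (Suc q) d e s"
    and k: "nats s ''k'' 0 = k" and dq: "d + q < n" and e: "e \<le> Suc q choose 2" "k + e = m"
    and out: "output_edges k s \<union> best_graph F (Suc q) d e = best_graph F n 0 m"
    using assms by (auto simp: emitting_def)
  define s0 where "s0 = nupdate ''q'' 0 q s"
  have s0: "filled n m F (Suc n) 0 0 s0" "counters q d e s0" "nats s0 ''k'' 0 = k"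
    "output_edges k s0 = output_edges k s"
    using fill count k by (auto simp: s0_def counters_def)
  have test: "bval s0 dominating_test \<longleftrightarrow> takes_dominating F q d e"
    using choice_values(3)[OF s0(1,2)] dq e(2) by simp
  have step: "runs_within (Cond dominating_test emit_dominating Skip) s0
      (1 + bcost dominating_test + (35 * n + 30)) (emitting n m F q)"
  proof (rule runs_within_Cond)
    assume "bval s0 dominating_test"
    then have dom: "takes_dominating F q d e"
      using test by simp
    note feasible = feasible_step(1)[OF e(1) dom]
    define s1 where "s1 = nupdate ''j'' 0 0 (nupdate ''e'' 0 (e - q) (nupdate ''d'' 0 (Suc d) s0))"
    have "filled n m F (Suc n) 0 0 s1" "counters q (Suc d) (e - q) s1" "nats s1 ''j'' 0 = 0"
      "nats s1 ''k'' 0 = k" and s1: "output_edges k s1 = output_edges k s"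
      using s0 by (auto simp: s1_def counters_def)
    from emit_star[OF this(1-4)]
    have "runs_within emit_star s1 (35 * n + 6) (emitting n m F q)"
    proof (rule runs_within_mono)
      show "q * 35 + 6 \<le> 35 * n + 6"
        using dq by simp
      fix s'
      assume s': "filled n m F (Suc n) 0 0 s' \<and> counters q (Suc d) (e - q) s' \<and>
        nats s' ''k'' 0 = k + q \<and> output_edges (k + q) s' = output_edges k s1 \<union> star q q"
      have "output_edges (k + q) s' \<union> best_graph F q (Suc d) (e - q) = best_graph F n 0 m"
        using s' s1 out dom by (simp add: Un_assoc)
      moreover have "(k + q) + (e - q) = m"
        using feasible e(2) by simp
      ultimately show "emitting n m F q s'"
        by (intro emittingI[of n m F s' q "Suc d" "e - q" "k + q"]) (use s' feasible dq in auto)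
    qed
    then show "runs_within emit_dominating s0 (35 * n + 30) (emitting n m F q)"
      unfolding emit_dominating_def
      by (intro runs_within_mono[OF runs_within_NAssign_Seq[OF runs_within_NAssign_Seq[OF runs_within_NAssign_Seq]]])
        (use s0(2) in \<open>auto simp: s1_def counters_def\<close>)
  next
    assume "\<not> bval s0 dominating_test"
    then have iso: "\<not> takes_dominating F q d e"
      using test by simp
    have "emitting n m F q s0"
      using s0 iso out dq e(2) feasible_step(2)[OF e(1) iso]
      by (intro emittingI[of n m F s0 q d e k]) auto
    then show "runs_within Skip s0 (35 * n + 30) (emitting n m F q)"
      by (intro runs_within_mono[OF runs_within_Skip]) auto
  qed
  have "nval s (NSub (var ''q'') (NConst 1)) = q"
    using count by (simp add: counters_def)
  then show ?thesis
    unfolding emit_vertex_def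
    by (intro runs_within_mono[OF runs_within_NAssign_Seq])
      (use step in \<open>auto simp: s0_def dominating_test_def dominating_value_def
        isolated_value_def index_exp_def\<close>)
qed

lemma emit_graph:
  assumes "emitting n m F n s"
  shows "runs_within emit_graph s (n * (35 * n + 155) + 5)
    (\<lambda>s'. output_edges m s' = best_graph F n 0 m)"
  unfolding emit_graph_def
proof (rule runs_within_mono[OF runs_within_While[where I = "\<lambda>i. emitting n m F (n - i)" and N = n
        and T = "35 * n + 150"]])
  fix i s'
  assume i: "i < n" "emitting n m F (n - i) s'"
  then have next_index: "n - i = Suc (n - Suc i)"
    by simp
  show "bval s' (NLess (NConst 0) (var ''q'')) \<and> runs_within emit_vertex s' (35 * n + 150) (emitting n m F (n - Suc i))"
    using emit_vertex[OF i(2)[unfolded next_index]] i by (auto simp: emitting_def counters_def)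
next
  fix s'
  assume end_state: "emitting n m F (n - n) s'"
  show "\<not> bval s' (NLess (NConst 0) (var ''q''))"
    using end_state by (auto simp: emitting_def counters_def)
  show "output_edges m s' = best_graph F n 0 m"
    using end_state by (auto simp: emitting_def numeral_2_eq_2)
qed (use assms in simp_all)

lemma optimizer:
  fixes f :: "nat \<Rightarrow> real"
  assumes "m \<le> n choose 2"
  defines "F \<equiv> (\<lambda>t. if t \<le> m then f t else 0)"
  shows "runs_within optimizer (input_store n m f)
     (n * (n * ((m + 1) * 215 + 28) + 26) + n * (35 * n + 155) + 30)
     (\<lambda>s. output_edges m s = best_graph F n 0 m)"
proof -
  let ?s = "input_store n m f"
  have start: "filled n m F 1 0 0 ?s" "nats ?s ''q'' 0 = 0"
    \<comment> \<open>the layer of \<open>0\<close> vertices is correct because memory is initially zero\<close>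
    by (auto simp: filled_def holds_input_def input_store_def F_def)
  have "runs_within (Seq (set_var ''d'' (NConst 0)) (Seq (set_var ''e'' (var ''m''))
      (Seq (set_var ''k'' (NConst 0)) emit_graph))) s
      (n * (35 * n + 155) + 20) (\<lambda>s. output_edges m s = best_graph F n 0 m)"
    if s: "filled n m F (Suc n) 0 0 s \<and> nats s ''q'' 0 = n" for s
  proof -
    have "emitting n m F n (nupdate ''k'' 0 0 (nupdate ''e'' 0 m (nupdate ''d'' 0 0 s)))"
      using s assms(1) by (simp add: emitting_def counters_def)
    from emit_graph[OF this] show ?thesis
      by (intro runs_within_mono[OF runs_within_NAssign_Seq[OF runs_within_NAssign_Seq[OF runs_within_NAssign_Seq]]])
        (use s filled_sizes(2)[of n m F "Suc n" 0 0 s] in auto)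
  qed
  from runs_within_Seq[OF fill_table[OF start] this] show ?thesis
    unfolding optimizer_def by (rule runs_within_mono) auto
qed

theorem theorem6p3:
  "\<exists>(c :: com) (K :: nat). \<forall>(n :: nat) (m :: nat) (f :: nat \<Rightarrow> real).
     0 < n \<longrightarrow> 0 < m \<longrightarrow> m \<le> n choose 2 \<longrightarrow> convex_upto m f \<longrightarrow>
     (\<exists>t s. runs c (input_store n m f) t s \<and> t \<le> K * (n\<^sup>2 * m) \<and>
            maximizes_degree_sum n m f (output_edges m s))"
proof (rule exI[of _ optimizer], rule exI[of _ 1000], intro allI impI)
  fix n m :: nat and f :: "nat \<Rightarrow> real"
  assume n: "0 < n" and m: "0 < m" "m \<le> n choose 2" and f: "convex_upto m f"
  define F where "F = (\<lambda>t. if t \<le> m then f t else 0)"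
  obtain t s where run: "runs optimizer (input_store n m f) t s"
    and t: "t \<le> n * (n * ((m + 1) * 215 + 28) + 26) + n * (35 * n + 155) + 30"
    and out: "output_edges m s = best_graph F n 0 m"
    using optimizer[OF m(2), of f] by (auto simp: runs_within_def F_def)
  have "n\<^sup>2 * 1 \<le> n\<^sup>2 * m" "n * 1 \<le> n\<^sup>2" "1 \<le> n"
    using n m(1) by (auto simp: power2_eq_square)
  moreover have "n * (n * ((m + 1) * 215 + 28) + 26) + n * (35 * n + 155) + 30 =
      215 * (n\<^sup>2 * m) + 278 * n\<^sup>2 + 181 * n + 30"
    by (simp add: algebra_simps power2_eq_square)
  ultimately have "t \<le> 1000 * (n\<^sup>2 * m)"
    using t by linarith
  moreover have "maximizes_degree_sum n m f (output_edges m s)"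
    unfolding out by (rule maximizes_best_graph[OF f m(2)]) (simp add: F_def)
  ultimately show "\<exists>t s. runs optimizer (input_store n m f) t s \<and> t \<le> 1000 * (n\<^sup>2 * m) \<and>
      maximizes_degree_sum n m f (output_edges m s)"
    using run by blast
qed

end
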